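(* For every integer $k\ge1$ there is a Boolean function $f_k:\{-1,1\}^{n_k}\to\{-1,1\}$ on a cube of dimension $$n_k=\frac{2^{k+2}(4^k-1)}3$$ such that $$\frac{\mathsf T_{\rm frac}(f_k)}{\mathsf B(f_k)}\ \ge\ \frac{3}{4\sqrt6}\sqrt k .$$ Consequently, $$\frac{\mathsf T_{\rm col}(f_k)}{\mathsf B(f_k)}\ \ge\ \frac{3}{4\sqrt6}\sqrt k\ \ge\ c\sqrt{\log n_k}$$ for a universal constant $c>0$, and the right-hand side tends to infinity with $k$. In particular, there is no dimension-free constant $C$ such that $\mathsf T_{\rm col}(f)\le C\,\mathsf B(f)$ for every $n$ and every Boolean function $f:\{-1,1\}^n\to\{-1,1\}$.
   Context: $\{-1,1\}^n$ carries the uniform probability measure. $x^{\oplus i}$ is $x$ with the $i$th coordinate flipped. $D_ig(x)=\frac{g(x)-g(x^{\oplus i})}2$, $L=\sum_{i=1}^n D_i$. A vector field is a map $V=(V_1,\dots,V_n):\{-1,1\}^n\to\mathbb R^n$, with $\operatorname{div}V(x)=\sum_{i=1}^n(V_i(x)-V_i(x^{\oplus i}))$. The Beckmann boundary is $\mathsf B(f)=\inf\{\mathbb E\|V(x)\|_2:\operatorname{div}V=Lf\}$ ($\|\cdot\|_2$ Euclidean norm). For Boolean $f:\{-1,1\}^n\to\{-1,1\}$ let $E_f$ be the set of sensitive edges, i.e. edges $\{x,x^{\oplus i}\}$ of the cube with $f(x)\ne f(x^{\oplus i})$. For a coloring $\chi:E_f\to\{\text{red},\text{blue}\}$ let $s_{f,\rm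 red}(x)=\#\{i: f(x)=1,\ f(x^{\oplus i})=-1,\ \{x,x^{\oplus i}\}\text{ red}\}$ and $s_{f,\rm blue}(x)=\#\{i: f(x)=-1,\ f(x^{\oplus i})=1,\ \{x,x^{\oplus i}\}\text{ blue}\}$, and $\mathsf T_{\rm col}^\chi(f)=\mathbb E\sqrt{s_{f,\rm red}}+\mathbb E\sqrt{s_{f,\rm blue}}$. Put $\mathsf T_{\rm col}(f)=\inf_\chi \mathsf T_{\rm col}^\chi(f)$. For a fractional coloring $\theta:E_f\to[0,1]$ let $$\mathsf T_\theta(f)=\mathbb E_x\Big(\sum_{i:\,f(x)=1,\,f(x^{\oplus i})=-1}\theta_{\{x,x^{\oplus i}\}}^2+\sum_{i:\,f(x)=-1,\,f(x^{\oplus i})=1}(1-\theta_{\{x,x^{\oplus i}\}})^2\Big)^{1/2},$$ and $\mathsf T_{\rm frac}(f)=\inf_\theta\mathsf T_\theta(f)$. *)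

theory Defs
  imports "HOL-Probability.Probability"
begin

text \<open>
  The dimension of the cube varies inside the statement, so points of the cube are functions on
  \<open>nat\<close>, with coordinates indexed by \<open>{..<n}\<close> (instead of \<open>1, \<dots>, n\<close>) and
  \<open>undefined\<close> elsewhere.
\<close>

definition cube :: "nat \<Rightarrow> (nat \<Rightarrow> real) set" where
  "cube n = {..<n} \<rightarrow>\<^sub>E {-1, 1}"

definition boolean_functions :: "nat \<Rightarrow> ((nat \<Rightarrow> real) \<Rightarrow> real) set" where
  "boolean_functions n = cube n \<rightarrow> {-1, 1}"

definition flip :: "(nat \<Rightarrow> real) \<Rightarrow> nat \<Rightarrow> nat \<Rightarrow> real" where
  "flip x i = x(i := - x i)"

definition cube_expectation :: "nat \<Rightarrow> ((nat \<Rightarrow> real) \<Rightarrow> real) \<Rightarrow> real" where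
  "cube_expectation n g = measure_pmf.expectation (pmf_of_set (cube n)) g"

definition discrete_deriv :: "nat \<Rightarrow> ((nat \<Rightarrow> real) \<Rightarrow> real) \<Rightarrow> (nat \<Rightarrow> real) \<Rightarrow> real" where
  "discrete_deriv i g x = (g x - g (flip x i)) / 2"

definition laplacian :: "nat \<Rightarrow> ((nat \<Rightarrow> real) \<Rightarrow> real) \<Rightarrow> (nat \<Rightarrow> real) \<Rightarrow> real" where
  "laplacian n g x = (\<Sum>i<n. discrete_deriv i g x)"

text \<open>
  A vector field is a function \<open>V\<close> whose component \<open>i < n\<close> at \<open>x\<close> is \<open>V x i\<close>;
  values at other points or indices are never used.
\<close>

definition divergence :: "nat \<Rightarrow> ((nat \<Rightarrow> real) \<Rightarrow> nat \<Rightarrow> real) \<Rightarrow> (nat \<Rightarrow> real) \<Rightarrow> real" where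
  "divergence n V x = (\<Sum>i<n. V x i - V (flip x i) i)"

definition beckmann :: "nat \<Rightarrow> ((nat \<Rightarrow> real) \<Rightarrow> real) \<Rightarrow> real" where
  "beckmann n f =
     Inf {cube_expectation n (\<lambda>x. L2_set (V x) {..<n}) | V.
            \<forall>x\<in>cube n. divergence n V x = laplacian n f x}"

definition sensitive_edges :: "nat \<Rightarrow> ((nat \<Rightarrow> real) \<Rightarrow> real) \<Rightarrow> (nat \<Rightarrow> real) set set" where
  "sensitive_edges n f =
     {{x, flip x i} | x i. x \<in> cube n \<and> i < n \<and> f x \<noteq> f (flip x i)}"

datatype colour = Red | Blue

definition s_red ::
  "nat \<Rightarrow> ((nat \<Rightarrow> real) \<Rightarrow> real) \<Rightarrow> ((nat \<Rightarrow> real) set \<Rightarrow> colour) \<Rightarrow> (nat \<Rightarrow> real) \<Rightarrow> nat" where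
  "s_red n f col x = card {i. i < n \<and> f x = 1 \<and> f (flip x i) = -1 \<and> col {x, flip x i} = Red}"

definition s_blue ::
  "nat \<Rightarrow> ((nat \<Rightarrow> real) \<Rightarrow> real) \<Rightarrow> ((nat \<Rightarrow> real) set \<Rightarrow> colour) \<Rightarrow> (nat \<Rightarrow> real) \<Rightarrow> nat" where
  "s_blue n f col x = card {i. i < n \<and> f x = -1 \<and> f (flip x i) = 1 \<and> col {x, flip x i} = Blue}"

definition T_coloring ::
  "nat \<Rightarrow> ((nat \<Rightarrow> real) \<Rightarrow> real) \<Rightarrow> ((nat \<Rightarrow> real) set \<Rightarrow> colour) \<Rightarrow> real" where
  "T_coloring n f col =
     cube_expectation n (\<lambda>x. sqrt (real (s_red n f col x))) +
     cube_expectation n (\<lambda>x. sqrt (real (s_blue n f col x)))"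

definition T_col :: "nat \<Rightarrow> ((nat \<Rightarrow> real) \<Rightarrow> real) \<Rightarrow> real" where
  "T_col n f = (INF col \<in> sensitive_edges n f \<rightarrow>\<^sub>E UNIV. T_coloring n f col)"

definition T_theta ::
  "nat \<Rightarrow> ((nat \<Rightarrow> real) \<Rightarrow> real) \<Rightarrow> ((nat \<Rightarrow> real) set \<Rightarrow> real) \<Rightarrow> real" where
  "T_theta n f \<theta> = cube_expectation n (\<lambda>x. sqrt (
     (\<Sum>i | i < n \<and> f x = 1 \<and> f (flip x i) = -1. (\<theta> {x, flip x i})\<^sup>2) +
     (\<Sum>i | i < n \<and> f x = -1 \<and> f (flip x i) = 1. (1 - \<theta> {x, flip x i})\<^sup>2)))"

definition T_frac :: "nat \<Rightarrow> ((nat \<Rightarrow> real) \<Rightarrow> real) \<Rightarrow> real" where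
  "T_frac n f = (INF \<theta> \<in> sensitive_edges n f \<rightarrow>\<^sub>E {0..1}. T_theta n f \<theta>)"

definition cube_dim :: "nat \<Rightarrow> nat" where
  "cube_dim k = 2 ^ (k + 2) * (4 ^ k - 1) div 3"

text \<open>Neither the division nor the subtraction above truncates.\<close>

lemma real_cube_dim: "real (cube_dim k) = 2 ^ (k + 2) * (4 ^ k - 1) / 3"
proof -
  have "(4::nat) ^ k mod 3 = 1"
    by (induction k) (simp_all add: mod_mult_right_eq[symmetric])
  then have "(3::nat) dvd 4 ^ k - 1"
    by (metis dvd_minus_mod)
  then have "3 dvd (2::nat) ^ (k + 2) * (4 ^ k - 1)" by (rule dvd_mult)
  then show ?thesis
    by (simp add: cube_dim_def real_of_nat_div of_nat_diff)
qed

end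

theory Submission
  imports Defs
begin

text \<open>
  The function that separates the functionals reads a state, a string of \<open>k\<close> bits, off the point by
  a linear map over the two-element field, and returns the parity of the bit length, or level, of the
  state. The coordinates come in widths \<open>m = 1, \<dots>, k\<close>. A flip of width \<open>m\<close> adds an \<open>m\<close>-bit string
  to the state, each such string being equally represented. So it makes a state of level at most \<open>m\<close>
  uniform among the \<open>m\<close>-bit strings and does not change a level above \<open>m\<close> (\<open>sum_transitions\<close>).
  The number \<open>4 * 2 ^ k * 4 ^ (k - m)\<close> of coordinates of width \<open>m\<close> grows by the factor 4 each time
  the probability of level \<open>m\<close> is halved, so that all levels have comparable weight in the expected
  square root of the sensitivity.

  In a fractional coloring every sensitive edge has to be paid at its own endpoints. Different levels
  consist of different points, and their costs add up: by a dual estimate with explicit edge weights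
  (\<open>T_theta_ge_edge_weights\<close>), every fractional coloring costs at least a constant times
  \<open>sqrt (2 ^ k) * k\<close> (\<open>T_theta_f_ge\<close>).

  A flow is free to go elsewhere. The Laplacian of \<open>f\<close> depends on the level only, and every
  point of level \<open>m \<ge> 1\<close> is joined by coordinates of width \<open>m\<close> to the same number of points in the single
  state 0. All levels can therefore send their charge to state 0, where it cancels. At a point in
  state 0 the \<open>k\<close> flows use disjoint sets of coordinates and have comparable norms. These add in squares,
  and the total cost is only of order \<open>sqrt (2 ^ k) * sqrt k\<close> (\<open>beckmann_f_le\<close>).

  The quotient of the two bounds is of order \<open>sqrt k\<close>, and the logarithm of the dimension is of
  order \<open>k\<close>.
\<close>

section \<open>Functionals on the cube\<close>

lemma finite_cube [simp]: "finite (cube n)"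
  by (simp add: cube_def finite_PiE)

lemma card_cube: "card (cube n) = 2 ^ n"
  by (simp add: cube_def card_PiE card_insert_if numeral_eq_Suc)

lemma cube_nonempty [simp]: "cube n \<noteq> {}"
  using card_cube[of n] by auto

lemma cube_expectation_eq: "cube_expectation n g = (\<Sum>x\<in>cube n. g x) / 2 ^ n"
  by (simp add: cube_expectation_def integral_pmf_of_set card_cube)

lemma flip_flip [simp]: "flip (flip x i) i = x"
  by (simp add: flip_def)

lemma flip_in_cube [simp]:
  assumes "i < n"
  shows "flip x i \<in> cube n \<longleftrightarrow> x \<in> cube n"
proof -
  have *: "flip y i \<in> cube n" if "y \<in> cube n" for y
    using that assms by (fastforce simp: cube_def flip_def PiE_iff extensional_def)
  show ?thesis using *[of x] *[of "flip x i"] by auto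
qed

lemma sum_cube_flip:
  assumes "i < n"
  shows "(\<Sum>x\<in>cube n. g (flip x i)) = (\<Sum>x\<in>cube n. g x)"
  by (rule sum.reindex_bij_witness[of _ "\<lambda>x. flip x i" "\<lambda>x. flip x i"]) (use assms in auto)

text \<open>
  A flow with nonzero divergence has a definite cost, because each entry of \<open>V\<close> enters just two
  divergences. This crude bound serves to show that the Beckmann boundary is positive.
\<close>

lemma abs_sum_divergence_le:
  "(\<Sum>x\<in>cube n. \<bar>divergence n V x\<bar>) \<le> 2 * n * (\<Sum>x\<in>cube n. L2_set (V x) {..<n})"
proof -
  have "(\<Sum>x\<in>cube n. \<bar>divergence n V x\<bar>)
      \<le> (\<Sum>x\<in>cube n. \<Sum>i<n. \<bar>V x i\<bar> + \<bar>V (flip x i) i\<bar>)"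
    unfolding divergence_def
    by (intro sum_mono order_trans[OF sum_abs]) (simp add: abs_triangle_ineq4)
  also have "\<dots> = (\<Sum>i<n. (\<Sum>x\<in>cube n. \<bar>V x i\<bar>) + (\<Sum>x\<in>cube n. \<bar>V (flip x i) i\<bar>))"
    by (subst sum.swap) (simp add: sum.distrib)
  also have "\<dots> = (\<Sum>i<n. 2 * (\<Sum>x\<in>cube n. \<bar>V x i\<bar>))"
    by (intro sum.cong refl) (simp add: sum_cube_flip[where g = "\<lambda>x. \<bar>V x _\<bar>"])
  also have "\<dots> = 2 * (\<Sum>x\<in>cube n. \<Sum>i<n. \<bar>V x i\<bar>)"
    by (subst sum.swap) (simp add: sum_distrib_left)
  also have "\<dots> \<le> 2 * (\<Sum>x\<in>cube n. n * L2_set (V x) {..<n})"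
  proof -
    have "(\<Sum>i<n. \<bar>V x i\<bar>) \<le> (\<Sum>i<n. L2_set (V x) {..<n})" for x
    proof (rule sum_mono)
      fix i assume "i \<in> {..<n}"
      then show "\<bar>V x i\<bar> \<le> L2_set (V x) {..<n}"
        using member_le_L2_set[of "{..<n}" i "\<lambda>i. \<bar>V x i\<bar>"] by (simp add: L2_set_def)
    qed
    then show ?thesis by (intro mult_left_mono sum_mono) auto
  qed
  finally show ?thesis by (simp add: sum_distrib_left mult.assoc)
qed

lemma beckmann_le:
  assumes "\<And>x. x \<in> cube n \<Longrightarrow> divergence n V x = laplacian n f x"
  shows "beckmann n f \<le> cube_expectation n (\<lambda>x. L2_set (V x) {..<n})"
  unfolding beckmann_def
proof (rule cInf_lower)
  show "bdd_below {cube_expectation n (\<lambda>x. L2_set (V x) {..<n}) |V.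
          \<forall>x\<in>cube n. divergence n V x = laplacian n f x}"
    by (rule bdd_belowI[of _ 0]) (auto simp: cube_expectation_eq intro!: divide_nonneg_pos sum_nonneg)
qed (use assms in auto)

lemma beckmann_pos:
  assumes V: "\<And>x. x \<in> cube n \<Longrightarrow> divergence n V x = laplacian n f x"
    and y: "y \<in> cube n" "laplacian n f y \<noteq> 0"
  shows "beckmann n f > 0"
proof -
  define \<delta> where "\<delta> = (\<Sum>x\<in>cube n. \<bar>laplacian n f x\<bar>)"
  have n: "n > 0" using y by (cases n) (auto simp: laplacian_def)
  have "\<delta> > 0" unfolding \<delta>_def by (rule sum_pos2[OF _ y(1)]) (use y in auto)
  have "\<delta> / (2 * n * 2 ^ n) \<le> beckmann n f"
    unfolding beckmann_def
  proof (rule cInf_greatest)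
    fix c assume "c \<in> {cube_expectation n (\<lambda>x. L2_set (V x) {..<n}) |V.
          \<forall>x\<in>cube n. divergence n V x = laplacian n f x}"
    then obtain U where c: "c = (\<Sum>x\<in>cube n. L2_set (U x) {..<n}) / 2 ^ n"
      and U: "\<forall>x\<in>cube n. divergence n U x = laplacian n f x"
      by (auto simp: cube_expectation_eq)
    have "\<delta> = (\<Sum>x\<in>cube n. \<bar>divergence n U x\<bar>)"
      unfolding \<delta>_def by (intro sum.cong) (auto simp: U)
    then have "\<delta> \<le> 2 * n * (\<Sum>x\<in>cube n. L2_set (U x) {..<n})"
      using abs_sum_divergence_le by simp
    then show "\<delta> / (2 * n * 2 ^ n) \<le> c"
      using n by (simp add: c field_simps)
  qed (use V in blast)
  moreover have "\<delta> / (2 * n * 2 ^ n) > 0" using n \<open>\<delta> > 0\<close> by simp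
  ultimately show ?thesis by linarith
qed

text \<open>
  This is the dual of the minimisation over fractional colorings. A weight on edges with Euclidean
  norm at most 1 at every vertex turns, by Cauchy--Schwarz, the square root at a vertex into a linear
  functional of the shares paid there; the two shares of an edge add up to 1, so the coloring drops
  out. Contrary to a competitor in the dual of \<open>beckmann\<close>, the weight need not be the gradient of a
  function, and this is the room in which the two functionals can differ. The factor 1/2 is there
  since the expectation sees every edge from both ends.
\<close>

lemma T_theta_ge_edge_weights:
  assumes f: "f \<in> boolean_functions n"
    and sym: "\<And>x i. x \<in> cube n \<Longrightarrow> i < n \<Longrightarrow> W (flip x i) i = W x i"
    and unit: "\<And>x. x \<in> cube n \<Longrightarrow> (\<Sum>i | i < n \<and> f (flip x i) \<noteq> f x. (W x i)\<^sup>2) \<le> 1"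
  shows "cube_expectation n (\<lambda>x. \<Sum>i | i < n \<and> f (flip x i) \<noteq> f x. W x i) / 2 \<le> T_theta n f \<theta>"
proof -
  define S where "S = (\<lambda>x. {i. i < n \<and> f (flip x i) \<noteq> f x})"
  define t where "t = (\<lambda>x i. if f x = 1 then \<theta> {x, flip x i} else 1 - \<theta> {x, flip x i})"
  have finS [simp]: "finite (S x)" for x by (simp add: S_def)
  have range: "f x = 1 \<or> f x = -1" if "x \<in> cube n" for x
    using f that by (auto simp: boolean_functions_def)
  have local: "(\<Sum>i\<in>S x. W x i * t x i) \<le> sqrt (
     (\<Sum>i | i < n \<and> f x = 1 \<and> f (flip x i) = -1. (\<theta> {x, flip x i})\<^sup>2) +
     (\<Sum>i | i < n \<and> f x = -1 \<and> f (flip x i) = 1. (1 - \<theta> {x, flip x i})\<^sup>2))"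
    (is "_ \<le> sqrt ?r") if x: "x \<in> cube n" for x
  proof -
    have r: "?r = (\<Sum>i\<in>S x. (t x i)\<^sup>2)"
      using range[OF x]
    proof
      assume "f x = 1"
      then have "{i. i < n \<and> f x = 1 \<and> f (flip x i) = -1} = S x"
        using range[of "flip x _"] x by (force simp: S_def)
      with \<open>f x = 1\<close> show ?thesis by (simp add: t_def)
    next
      assume "f x = -1"
      then have "{i. i < n \<and> f x = -1 \<and> f (flip x i) = 1} = S x"
        using range[of "flip x _"] x by (force simp: S_def)
      with \<open>f x = -1\<close> show ?thesis by (simp add: t_def)
    qed
    have "(\<Sum>i\<in>S x. W x i * t x i)\<^sup>2 \<le> (\<Sum>i\<in>S x. (W x i)\<^sup>2) * (\<Sum>i\<in>S x. (t x i)\<^sup>2)"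
      by (rule Cauchy_Schwarz_ineq_sum)
    also have "\<dots> \<le> 1 * (\<Sum>i\<in>S x. (t x i)\<^sup>2)"
      using unit[OF x] by (intro mult_right_mono sum_nonneg) (auto simp: S_def)
    finally show ?thesis by (simp add: r real_le_rsqrt)
  qed
  \<comment> \<open>The two endpoints of a sensitive edge together pay the full weight of the edge.\<close>
  have share: "t (flip x i) i = 1 - t x i" if "x \<in> cube n" "i \<in> S x" for x i
    using that range[of x] range[of "flip x i"]
    by (auto simp: t_def S_def insert_commute)
  define g where "g = (\<lambda>x i. if i \<in> S x then W x i else 0)"
  have Sflip: "i \<in> S (flip x i) \<longleftrightarrow> i \<in> S x" for x i by (auto simp: S_def)
  have restrict: "(\<Sum>i\<in>S x. h i) = (\<Sum>i<n. if i \<in> S x then h i else 0)" for x and h :: "nat \<Rightarrow> real"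
    by (subst sum.inter_restrict[symmetric]) (auto simp: S_def intro!: sum.cong)
  have "(\<Sum>x\<in>cube n. \<Sum>i\<in>S x. W x i * t x i) = (\<Sum>i<n. \<Sum>x\<in>cube n. g x i * t x i)"
    by (subst sum.swap) (auto simp: restrict g_def intro!: sum.cong)
  also have "\<dots> = (\<Sum>i<n. (\<Sum>x\<in>cube n. g x i) / 2)"
  proof (rule sum.cong[OF refl])
    fix i assume i: "i \<in> {..<n}"
    have "(\<Sum>x\<in>cube n. g x i * t x i) = (\<Sum>x\<in>cube n. g (flip x i) i * t (flip x i) i)"
      using i by (simp add: sum_cube_flip[where g = "\<lambda>x. g x i * t x i"])
    also have "\<dots> = (\<Sum>x\<in>cube n. g x i * (1 - t x i))"
      using i by (intro sum.cong refl) (auto simp: g_def Sflip sym share)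
    finally have "2 * (\<Sum>x\<in>cube n. g x i * t x i) = (\<Sum>x\<in>cube n. g x i)"
      by (simp add: algebra_simps sum_subtractf)
    then show "(\<Sum>x\<in>cube n. g x i * t x i) = (\<Sum>x\<in>cube n. g x i) / 2" by simp
  qed
  also have "\<dots> = (\<Sum>x\<in>cube n. \<Sum>i\<in>S x. W x i) / 2"
    unfolding sum_divide_distrib[symmetric] by (subst sum.swap) (simp add: restrict g_def)
  finally have "(\<Sum>x\<in>cube n. \<Sum>i\<in>S x. W x i) / 2 = (\<Sum>x\<in>cube n. \<Sum>i\<in>S x. W x i * t x i)" ..
  also have "\<dots> \<le> 2 ^ n * T_theta n f \<theta>"
    using sum_mono[OF local] by (simp add: T_theta_def cube_expectation_eq)
  finally show ?thesis
    by (simp add: cube_expectation_eq S_def field_simps)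
qed

text \<open>
  A coloring is a fractional coloring with values 0 and 1, and at a given point only one of the two
  colors contributes, so no constant is lost in merging the two square roots into one.
\<close>

lemma T_coloring_eq_T_theta:
  "T_coloring n f col = T_theta n f (\<lambda>e. if col e = Red then 1 else 0)"
proof -
  have *: "sqrt (real (s_red n f col x)) + sqrt (real (s_blue n f col x)) = sqrt (
     (\<Sum>i | i < n \<and> f x = 1 \<and> f (flip x i) = -1. (if col {x, flip x i} = Red then 1 else 0)\<^sup>2) +
     (\<Sum>i | i < n \<and> f x = -1 \<and> f (flip x i) = 1. (1 - (if col {x, flip x i} = Red then 1 else 0))\<^sup>2))"
    for x
  proof -
    have "real (s_red n f col x)
        = (\<Sum>i | i < n \<and> f x = 1 \<and> f (flip x i) = -1. (if col {x, flip x i} = Red then 1 else 0)\<^sup>2)"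
      unfolding s_red_def of_nat_sum card_eq_sum
      by (rule sum.mono_neutral_cong_left) auto
    moreover have "real (s_blue n f col x)
        = (\<Sum>i | i < n \<and> f x = -1 \<and> f (flip x i) = 1. (1 - (if col {x, flip x i} = Red then 1 else 0))\<^sup>2)"
      unfolding s_blue_def of_nat_sum card_eq_sum
      by (rule sum.mono_neutral_cong_left) (auto intro: colour.exhaust)
    moreover have "s_red n f col x = 0 \<or> s_blue n f col x = 0"
      by (auto simp: s_red_def s_blue_def)
    ultimately show ?thesis by auto
  qed
  show ?thesis
    unfolding T_coloring_def T_theta_def cube_expectation_eq
    by (simp only: *[symmetric] sum.distrib add_divide_distrib)
qed

lemma T_frac_geI:
  assumes "\<And>\<theta>. b \<le> T_theta n f \<theta>"
  shows "b \<le> T_frac n f" "b \<le> T_col n f"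
proof -
  show "b \<le> T_frac n f"
    unfolding T_frac_def
    by (rule cINF_greatest) (use assms in \<open>auto simp: PiE_eq_empty_iff\<close>)
  show "b \<le> T_col n f"
    unfolding T_col_def
    by (rule cINF_greatest) (use assms in \<open>auto simp: PiE_eq_empty_iff T_coloring_eq_T_theta\<close>)
qed

section \<open>Levels of binary strings\<close>

text \<open>The bit length: level \<open>m \<ge> 1\<close> is the dyadic block from \<open>2 ^ (m - 1)\<close> to \<open>2 ^ m - 1\<close>.\<close>

definition level :: "nat \<Rightarrow> nat" where
  "level s = (LEAST m. s < 2 ^ m)"

lemma level_le_iff: "level s \<le> m \<longleftrightarrow> s < 2 ^ m"
proof
  have "s < 2 ^ level s"
    unfolding level_def by (rule LeastI[of _ s]) (rule less_exp)
  also assume "level s \<le> m"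
  then have "(2::nat) ^ level s \<le> 2 ^ m" by (rule power_increasing) simp
  finally show "s < 2 ^ m" .
qed (simp add: level_def Least_le)

lemma level_0 [simp]: "level 0 = 0"
  using level_le_iff[of 0 0] by simp

lemma level_eq_0_iff [simp]: "level s = 0 \<longleftrightarrow> s = 0"
  using level_le_iff[of s 0] by simp

lemma level_eq_Suc:
  assumes "2 ^ m \<le> s" "s < 2 ^ Suc m"
  shows "level s = Suc m"
  using assms level_le_iff[of s m] level_le_iff[of s "Suc m"] by (simp add: not_less)

lemma xor_less_power_iff:
  assumes "d < 2 ^ m"
  shows "xor s d < 2 ^ m \<longleftrightarrow> s < (2::nat) ^ m"
proof -
  have *: "xor t d < 2 ^ m" if "t < 2 ^ m" for t
    using that assms by (metis take_bit_nat_eq_self_iff take_bit_xor)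
  have "xor (xor s d) d = s" by (simp add: xor.assoc)
  with *[of s] *[of "xor s d"] show ?thesis by auto
qed

text \<open>Flipping bits below the leading one leaves the bit length alone.\<close>

lemma level_xor:
  assumes "d < 2 ^ m" "m < level s"
  shows "level (xor s d) = level s"
proof -
  have "level (xor s d) \<le> r \<longleftrightarrow> level s \<le> r" for r
  proof (cases "m \<le> r")
    case True
    then have "d < 2 ^ r" using assms(1) by (metis level_le_iff le_trans)
    then show ?thesis by (simp add: level_le_iff xor_less_power_iff)
  next
    case False
    then have "\<not> level (xor s d) \<le> m"
      using assms(2) xor_less_power_iff[OF assms(1), of s] by (simp add: level_le_iff flip: not_le)
    then show ?thesis using False assms(2) by linarith
  qed
  then show ?thesis by (metis order_refl antisym)
qed

definition level_size :: "nat \<Rightarrow> real" where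
  "level_size m = (if m = 0 then 1 else 2 ^ (m - 1))"

lemma level_size_Suc [simp]: "level_size (Suc m) = 2 ^ m" "level_size 0 = 1"
  by (simp_all add: level_size_def)

lemma sum_by_level:
  fixes h :: "nat \<Rightarrow> real"
  shows "(\<Sum>s<2 ^ k. h (level s)) = (\<Sum>m\<le>k. level_size m * h m)"
proof (induction k)
  case (Suc k)
  have split: "{..<2 ^ Suc k} = {..<2 ^ k} \<union> {2 ^ k..<2 ^ Suc k :: nat}" by auto
  have "(\<Sum>s<2 ^ Suc k. h (level s))
      = (\<Sum>s<2 ^ k. h (level s)) + (\<Sum>s\<in>{2 ^ k..<2 ^ Suc k :: nat}. h (level s))"
    unfolding split by (rule sum.union_disjoint) auto
  also have "(\<Sum>s\<in>{2 ^ k..<2 ^ Suc k :: nat}. h (level s))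
      = (\<Sum>s\<in>{2 ^ k..<2 ^ Suc k :: nat}. h (Suc k))"
    by (intro sum.cong refl arg_cong[of _ _ h] level_eq_Suc) auto
  finally show ?case by (simp add: Suc.IH)
qed (simp add: lessThan_Suc)

lemma sum_atMost_split: "(\<Sum>m\<le>k. h m) = h 0 + (\<Sum>m = 1..k. h m)" for h :: "nat \<Rightarrow> real"
  by (simp add: atMost_atLeast0 sum.atLeast_Suc_atMost)

lemma sum_alternating_levels:
  "(\<Sum>m\<le>r. level_size m * (-1) ^ m) = ((-2) ^ r + 2) / (3::real)"
proof (induction r)
  case (Suc r)
  have "(-2::real) ^ r = (-1) ^ r * 2 ^ r" by (simp flip: power_mult_distrib)
  then show ?case by (simp add: Suc.IH field_simps)
qed simp

lemma sum_level_size: "(\<Sum>m\<le>r. level_size m) = 2 ^ r"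
  by (induction r) auto

section \<open>The layered parity function\<close>

text \<open>
  The value at \<open>x\<close> of the linear map over the two-element field whose columns are \<open>v\<close>, with bit
  strings written as numbers; the coordinate value \<open>-1\<close> stands for the bit 1.
\<close>

primrec syndrome :: "(nat \<Rightarrow> nat) \<Rightarrow> nat \<Rightarrow> (nat \<Rightarrow> real) \<Rightarrow> nat" where
  "syndrome v 0 x = 0"
| "syndrome v (Suc n) x = xor (syndrome v n x) (if x n = -1 then v n else 0)"

lemma syndrome_cong:
  "(\<And>a. a < n \<Longrightarrow> x a = y a) \<Longrightarrow> syndrome v n x = syndrome v n y"
  by (induction n) auto

lemma syndrome_flip:
  assumes "x \<in> cube n" "a < n"
  shows "syndrome v n (flip x a) = xor (syndrome v n x) (v a)"
proof -
  have "x a = 1 \<or> x a = -1" using assms by (auto simp: cube_def PiE_iff)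
  with assms(2) show ?thesis
  proof (induction n)
    case (Suc n)
    show ?case
    proof (cases "a = n")
      case True
      have "syndrome v n (flip x a) = syndrome v n x"
        by (rule syndrome_cong) (use True in \<open>auto simp: flip_def\<close>)
      moreover have "flip x a a = - x a" by (simp add: flip_def)
      ultimately show ?thesis using True Suc.prems by (auto simp: xor.assoc)
    next
      case False
      then have "syndrome v n (flip x a) = xor (syndrome v n x) (v a)"
        using Suc by simp
      moreover have "flip x a n = x n" using False by (simp add: flip_def)
      ultimately show ?thesis by (simp add: ac_simps)
    qed
  qed simp
qed

lemma syndrome_less:
  "(\<And>a. a < n \<Longrightarrow> v a < 2 ^ k) \<Longrightarrow> syndrome v n x < 2 ^ k"
  by (induction n) (auto simp: xor_less_power_iff)

text \<open>
  A coordinate of width \<open>m\<close> adds some \<open>m\<close>-bit string to the state, and all strings of that width are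
  equally represented. Hence a random flip of width \<open>m\<close> makes the last \<open>m\<close> bits of the state uniform.
  The multiplicity is chosen so that there are \<open>4 * 2 ^ k * 4 ^ (k - m)\<close> coordinates of width \<open>m\<close>:
  level \<open>m \<ge> 1\<close> has probability proportional to \<open>2 ^ m\<close>, while its points have sensitivity of order
  \<open>2 ^ k * 4 ^ (k - m)\<close>, so the levels contribute comparable amounts to the expected square root of
  the sensitivity.
\<close>

locale layered_parity =
  fixes k n :: nat and width shift :: "nat \<Rightarrow> nat"
  assumes k: "k \<ge> 1"
    and width_range: "\<And>a. a < n \<Longrightarrow> width a \<in> {1..k}"
    and shift_less: "\<And>a. a < n \<Longrightarrow> shift a < 2 ^ width a"
    and multiplicity: "\<And>m d. m \<in> {1..k} \<Longrightarrow> d < 2 ^ m \<Longrightarrow>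
          card {a. a < n \<and> width a = m \<and> shift a = d} = 4 * 8 ^ (k - m)"
begin

definition state :: "(nat \<Rightarrow> real) \<Rightarrow> nat" where
  "state x = syndrome shift n x"

definition f :: "(nat \<Rightarrow> real) \<Rightarrow> real" where
  "f x = (-1) ^ level (state x)"

lemma f_boolean: "f \<in> boolean_functions n"
  by (auto simp: boolean_functions_def f_def minus_one_power_iff)

lemma state_flip: "x \<in> cube n \<Longrightarrow> a < n \<Longrightarrow> state (flip x a) = xor (state x) (shift a)"
  by (simp add: state_def syndrome_flip)

lemma state_less: "state x < 2 ^ k"
  unfolding state_def
proof (rule syndrome_less)
  fix a assume a: "a < n"
  have "shift a < 2 ^ width a" by (rule shift_less[OF a])
  also have "\<dots> \<le> 2 ^ k" using width_range[OF a] by (intro power_increasing) auto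
  finally show "shift a < 2 ^ k" .
qed

lemma level_state_le: "level (state x) \<le> k"
  using state_less by (simp add: level_le_iff)

lemma sum_coordinates:
  fixes h :: "nat \<Rightarrow> nat \<Rightarrow> real"
  shows "(\<Sum>a<n. h (width a) (shift a)) = (\<Sum>m = 1..k. 4 * 8 ^ (k - m) * (\<Sum>d<2 ^ m. h m d))"
proof -
  let ?T = "SIGMA m:{1..k}. {..<2 ^ m :: nat}" and ?g = "\<lambda>a. (width a, shift a)"
  have "(\<Sum>a<n. h (width a) (shift a))
      = (\<Sum>y\<in>?T. \<Sum>a\<in>{a \<in> {..<n}. ?g a = y}. h (width a) (shift a))"
    by (rule sum.group[symmetric]) (use width_range shift_less in auto)
  also have "\<dots> = (\<Sum>y\<in>?T. 4 * 8 ^ (k - fst y) * h (fst y) (snd y))"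
  proof (rule sum.cong[OF refl])
    fix y assume y: "y \<in> ?T"
    have "(\<Sum>a\<in>{a \<in> {..<n}. ?g a = y}. h (width a) (shift a))
        = (\<Sum>a\<in>{a. a < n \<and> width a = fst y \<and> shift a = snd y}. h (fst y) (snd y))"
      by (rule sum.cong) auto
    also have "\<dots> = 4 * 8 ^ (k - fst y) * h (fst y) (snd y)"
      using y multiplicity[of "fst y" "snd y"] by auto
    finally show "(\<Sum>a\<in>{a \<in> {..<n}. ?g a = y}. h (width a) (shift a))
        = 4 * 8 ^ (k - fst y) * h (fst y) (snd y)" .
  qed
  also have "\<dots> = (\<Sum>m = 1..k. \<Sum>d<2 ^ m. 4 * 8 ^ (k - m) * h m d)"
    by (subst sum.Sigma) (auto simp: case_prod_unfold)
  finally show ?thesis by (simp add: sum_distrib_left)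
qed

lemma sum_xor:
  fixes h :: "nat \<Rightarrow> real"
  assumes "s < 2 ^ m"
  shows "(\<Sum>d<2 ^ m. h (xor s d)) = (\<Sum>t<2 ^ m. h t)"
proof -
  have "xor s (xor s t) = t" for t by (simp flip: xor.assoc)
  moreover have "xor s t < 2 ^ m" if "t < 2 ^ m" for t
    using xor_less_power_iff[OF that, of s] assms by simp
  ultimately show ?thesis
    by (intro sum.reindex_bij_witness[of _ "xor s" "xor s"]) auto
qed

text \<open>
  After a flip of width \<open>m\<close>, a state of level at most \<open>m\<close> is uniform among the \<open>m\<close>-bit strings, while
  a state of higher level keeps its level. In particular the distribution of the new level depends on
  the old state only through its level, which is why everything below can be computed on levels.
\<close>

lemma sum_transitions:
  fixes \<phi> :: "nat \<Rightarrow> nat \<Rightarrow> real"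
  assumes x: "x \<in> cube n"
  shows "(\<Sum>a<n. \<phi> (width a) (level (state (flip x a)))) =
    (\<Sum>m = 1..k. 4 * 8 ^ (k - m) *
       (if level (state x) \<le> m then \<Sum>j\<le>m. level_size j * \<phi> m j else 2 ^ m * \<phi> m (level (state x))))"
proof -
  have "(\<Sum>a<n. \<phi> (width a) (level (state (flip x a))))
      = (\<Sum>a<n. \<phi> (width a) (level (xor (state x) (shift a))))"
    by (simp add: state_flip x)
  also have "\<dots> = (\<Sum>m = 1..k. 4 * 8 ^ (k - m) * (\<Sum>d<2 ^ m. \<phi> m (level (xor (state x) d))))"
    by (rule sum_coordinates)
  also have "\<dots> = (\<Sum>m = 1..k. 4 * 8 ^ (k - m) *
       (if level (state x) \<le> m then \<Sum>j\<le>m. level_size j * \<phi> m j else 2 ^ m * \<phi> m (level (state x))))"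
  proof (rule sum.cong[OF refl])
    fix m
    have "(\<Sum>d<2 ^ m. \<phi> m (level (xor (state x) d))) =
       (if level (state x) \<le> m then \<Sum>j\<le>m. level_size j * \<phi> m j else 2 ^ m * \<phi> m (level (state x)))"
      using sum_xor[of "state x" m "\<lambda>t. \<phi> m (level t)"] sum_by_level[of "\<phi> m" m]
      by (auto simp: level_xor level_le_iff[symmetric] not_le)
    then show "4 * 8 ^ (k - m) * (\<Sum>d<2 ^ m. \<phi> m (level (xor (state x) d))) = 4 * 8 ^ (k - m) *
       (if level (state x) \<le> m then \<Sum>j\<le>m. level_size j * \<phi> m j else 2 ^ m * \<phi> m (level (state x)))"
      by simp
  qed
  finally show ?thesis .
qed

text \<open>
  A coordinate of width \<open>k\<close> that adds \<open>s\<close> exchanges the fibres over \<open>s\<close> and 0, so the state of a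
  uniform point is uniform.
\<close>

lemma card_state_fibre:
  assumes "s < 2 ^ k"
  shows "card {x \<in> cube n. state x = s} * 2 ^ k = 2 ^ n"
proof -
  have eq: "card {x \<in> cube n. state x = t} = card {x \<in> cube n. state x = 0}" if t: "t < 2 ^ k" for t
  proof -
    have "card {a. a < n \<and> width a = k \<and> shift a = t} \<noteq> 0"
      using multiplicity[of k t] k t by auto
    then obtain a where a: "a < n" "shift a = t"
      by (auto simp: card_eq_0_iff)
    have "bij_betw (\<lambda>x. flip x a) {x \<in> cube n. state x = t} {x \<in> cube n. state x = 0}"
      by (rule bij_betw_byWitness[of _ "\<lambda>x. flip x a"]) (use a in \<open>auto simp: state_flip\<close>)
    then show ?thesis by (rule bij_betw_same_card)
  qed
  have range: "state ` cube n \<subseteq> {..<2 ^ k}" using state_less by auto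
  have "2 ^ n = (\<Sum>x\<in>cube n. 1::nat)" by (simp add: card_cube)
  also have "\<dots> = (\<Sum>t<2 ^ k. \<Sum>x\<in>{x \<in> cube n. state x = t}. 1)"
    by (rule sum.group[OF finite_cube finite_lessThan range, symmetric])
  also have "\<dots> = card {x \<in> cube n. state x = 0} * 2 ^ k"
  proof -
    have "(\<Sum>x\<in>{x \<in> cube n. state x = t}. 1) = card {x \<in> cube n. state x = 0}" if "t \<in> {..<2 ^ k}" for t
      using eq[of t] that by (simp only: card_eq_sum lessThan_iff)
    then have "(\<Sum>t<2 ^ k. \<Sum>x\<in>{x \<in> cube n. state x = t}. 1)
        = (\<Sum>t<(2::nat) ^ k. card {x \<in> cube n. state x = 0})"
      by (rule sum.cong[OF refl])
    then show ?thesis by (simp only: sum_constant card_lessThan mult.commute of_nat_id)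
  qed
  finally show ?thesis using eq[OF assms] by (simp only:)
qed

lemma expectation_state:
  fixes h :: "nat \<Rightarrow> real"
  shows "cube_expectation n (\<lambda>x. h (state x)) = (\<Sum>s<2 ^ k. h s) / 2 ^ k"
proof -
  have range: "state ` cube n \<subseteq> {..<2 ^ k}" using state_less by auto
  have "(\<Sum>x\<in>cube n. h (state x)) = (\<Sum>s<2 ^ k. \<Sum>x\<in>{x \<in> cube n. state x = s}. h (state x))"
    by (rule sum.group[OF finite_cube finite_lessThan range, symmetric])
  also have "\<dots> = (\<Sum>s<2 ^ k. 2 ^ n / 2 ^ k * h s)"
  proof (rule sum.cong[OF refl])
    fix s :: nat assume "s \<in> {..<2 ^ k}"
    then have "real (card {x \<in> cube n. state x = s}) * 2 ^ k = 2 ^ n"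
      using arg_cong[OF card_state_fibre[of s], of real] by simp
    then show "(\<Sum>x\<in>{x \<in> cube n. state x = s}. h (state x)) = 2 ^ n / 2 ^ k * h s"
      by (simp add: field_simps)
  qed
  also have "\<dots> = 2 ^ n / 2 ^ k * (\<Sum>s<2 ^ k. h s)" by (rule sum_distrib_left[symmetric])
  finally show ?thesis by (simp add: cube_expectation_eq)
qed

lemma expectation_level:
  "cube_expectation n (\<lambda>x. h (level (state x))) = (\<Sum>m\<le>k. level_size m * h m) / 2 ^ k"
  using expectation_state[of "\<lambda>s. h (level s)"] by (simp add: sum_by_level)

section \<open>A cheap flow through the bottom level\<close>

text \<open>
  The Laplacian of \<open>f\<close> at a state of level \<open>p\<close>. Widths below \<open>p\<close> do not change the level and
  contribute nothing.
\<close>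

definition charge :: "nat \<Rightarrow> real" where
  "charge p = (\<Sum>m = 1..k. 4 * 8 ^ (k - m) *
     (if p \<le> m then \<Sum>j\<le>m. level_size j * (((-1) ^ p - (-1) ^ j) / 2) else 0))"

lemma laplacian_f:
  assumes "x \<in> cube n"
  shows "laplacian n f x = charge (level (state x))"
proof -
  let ?p = "level (state x)"
  have "laplacian n f x = (\<Sum>a<n. ((-1) ^ ?p - (-1) ^ level (state (flip x a))) / 2)"
    by (simp add: laplacian_def discrete_deriv_def f_def)
  also have "\<dots> = charge ?p"
    unfolding charge_def
    using sum_transitions[OF assms, of "\<lambda>m q. ((-1) ^ ?p - (-1) ^ q) / 2"] by (simp cong: if_cong)
  finally show ?thesis .
qed

text \<open>
  Transitions within the \<open>m\<close>-bit strings are symmetric, so their contributions cancel in pairs.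
\<close>

lemma charges_cancel: "(\<Sum>p\<le>k. level_size p * charge p) = 0"
proof -
  have "(\<Sum>p\<le>k. level_size p * charge p) = (\<Sum>m = 1..k. 4 * 8 ^ (k - m) *
     (\<Sum>p\<le>k. if p \<le> m then \<Sum>j\<le>m. level_size p * level_size j * (((-1) ^ p - (-1) ^ j) / 2) else 0))"
    unfolding charge_def sum_distrib_left
    by (subst sum.swap) (intro sum.cong refl, auto simp: sum_distrib_left algebra_simps)
  also have "\<dots> = 0"
  proof (intro sum.neutral ballI)
    fix m assume m: "m \<in> {1..k}"
    define A where "A = (\<Sum>p\<le>m. \<Sum>j\<le>m. level_size p * level_size j * (((-1) ^ p - (-1) ^ j) / 2))"
    have "A = (\<Sum>p\<le>m. \<Sum>j\<le>m. level_size j * level_size p * (((-1) ^ j - (-1) ^ p) / 2))"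
      unfolding A_def by (rule sum.swap)
    also have "\<dots> = - A"
      unfolding A_def sum_negf[symmetric] by (intro sum.cong refl) (simp add: field_simps)
    finally have "A = 0" by simp
    moreover have "(\<Sum>p\<le>k. if p \<le> m then \<Sum>j\<le>m. level_size p * level_size j * (((-1) ^ p - (-1) ^ j) / 2) else 0) = A"
      unfolding A_def using m
      by (subst sum.inter_filter[symmetric]) (auto intro!: sum.cong)
    ultimately show "4 * 8 ^ (k - m) * (\<Sum>p\<le>k. if p \<le> m then \<Sum>j\<le>m. level_size p * level_size j * (((-1) ^ p - (-1) ^ j) / 2) else 0) = (0::real)"
      by simp
  qed
  finally show ?thesis .
qed

text \<open>
  Every point of level \<open>m \<ge> 1\<close> has exactly \<open>4 * 8 ^ (k - m)\<close> neighbours in state 0 across coordinates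
  of width \<open>m\<close>, and exchanges its whole charge with them in equal parts. The flow is booked at the
  endpoint in state 0. There the flows of the \<open>k\<close> levels meet on disjoint sets of coordinates, so
  their norms add in squares.
\<close>

definition flow :: "(nat \<Rightarrow> real) \<Rightarrow> nat \<Rightarrow> real" where
  "flow x a = (if state x = 0 \<and> level (shift a) = width a
     then - charge (width a) / (4 * 8 ^ (k - width a)) else 0)"

lemma sum_over_exact_level:
  fixes c :: "nat \<Rightarrow> real"
  shows "(\<Sum>a<n. if level (shift a) = width a then c (width a) else 0)
    = (\<Sum>m = 1..k. 4 * 8 ^ (k - m) * (2 ^ (m - 1) * c m))"
proof -
  have "(\<Sum>a<n. if level (shift a) = width a then c (width a) else 0)
      = (\<Sum>m = 1..k. 4 * 8 ^ (k - m) * (\<Sum>d<2 ^ m. if level d = m then c m else 0))"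
    by (rule sum_coordinates)
  also have "\<dots> = (\<Sum>m = 1..k. 4 * 8 ^ (k - m) * (2 ^ (m - 1) * c m))"
  proof (rule sum.cong[OF refl])
    fix m assume "m \<in> {1..k}"
    then have "(\<Sum>d<2 ^ m. if level d = m then c m else 0) = 2 ^ (m - 1) * c m"
      using sum_by_level[of "\<lambda>j. if j = m then c m else 0" m]
      by (simp add: if_distrib[of "\<lambda>u. _ * u"] level_size_def cong: if_cong)
    then show "4 * 8 ^ (k - m) * (\<Sum>d<2 ^ m. if level d = m then c m else 0)
        = 4 * 8 ^ (k - m) * (2 ^ (m - 1) * c m)" by simp
  qed
  finally show ?thesis .
qed

text \<open>
  At level \<open>m \<ge> 1\<close> this holds by the choice of the flow. In state 0 it is then forced by
  \<open>charges_cancel\<close>, because the flow there depends only on width and level.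
\<close>

lemma divergence_flow:
  assumes x: "x \<in> cube n"
  shows "divergence n flow x = laplacian n f x"
proof (cases "state x = 0")
  case True
  have "divergence n flow x = (\<Sum>a<n. if level (shift a) = width a
      then - charge (width a) / (4 * 8 ^ (k - width a)) else 0)"
    unfolding divergence_def
  proof (rule sum.cong[OF refl])
    fix a assume a: "a \<in> {..<n}"
    have "flow (flip x a) a = 0"
      using width_range[of a] a x True by (auto simp: flow_def state_flip)
    then show "flow x a - flow (flip x a) a = (if level (shift a) = width a
      then - charge (width a) / (4 * 8 ^ (k - width a)) else 0)"
      using True by (simp add: flow_def)
  qed
  also have "\<dots> = (\<Sum>m = 1..k. 4 * 8 ^ (k - m) * (2 ^ (m - 1) * (- charge m / (4 * 8 ^ (k - m)))))"
    by (rule sum_over_exact_level)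
  also have "\<dots> = - (\<Sum>m = 1..k. level_size m * charge m)"
    unfolding sum_negf[symmetric] by (intro sum.cong) (auto simp: level_size_def)
  also have "\<dots> = charge 0"
    using charges_cancel by (simp add: sum_atMost_split)
  finally show ?thesis using x True by (simp add: laplacian_f)
next
  case False
  define p where "p = level (state x)"
  have "p \<noteq> 0" using False by (simp add: p_def)
  then have p: "p \<in> {1..k}" using level_state_le[of x, folded p_def] by auto
  have "state x < 2 ^ p" unfolding p_def by (simp flip: level_le_iff)
  have "divergence n flow x = (\<Sum>a<n. if width a = p \<and> shift a = state x then charge p / (4 * 8 ^ (k - p)) else 0)"
    unfolding divergence_def
  proof (rule sum.cong[OF refl])
    fix a assume a: "a \<in> {..<n}"
    have "xor (state x) (shift a) = 0 \<longleftrightarrow> shift a = state x"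
      by (metis xor.assoc xor_self_eq xor.left_neutral xor.right_neutral)
    then show "flow x a - flow (flip x a) a =
        (if width a = p \<and> shift a = state x then charge p / (4 * 8 ^ (k - p)) else 0)"
      using False a x by (auto simp: flow_def state_flip p_def)
  qed
  also have "\<dots> = (\<Sum>a | a < n \<and> width a = p \<and> shift a = state x. charge p / (4 * 8 ^ (k - p)))"
    by (subst sum.inter_filter[symmetric]) (auto intro!: sum.cong)
  also have "\<dots> = charge p"
    using multiplicity[OF p \<open>state x < 2 ^ p\<close>] by simp
  finally show ?thesis using x by (simp add: laplacian_f p_def)
qed

lemma flow_cost:
  "cube_expectation n (\<lambda>x. L2_set (flow x) {..<n})
    = sqrt (\<Sum>m = 1..k. 2 ^ (m - 1) * (charge m)\<^sup>2 / (4 * 8 ^ (k - m))) / 2 ^ k"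
proof -
  define R where "R = sqrt (\<Sum>m = 1..k. 2 ^ (m - 1) * (charge m)\<^sup>2 / (4 * 8 ^ (k - m)))"
  have "L2_set (flow x) {..<n} = (if level (state x) = 0 then R else 0)" for x
  proof (cases "state x = 0")
    case True
    have "(\<Sum>a<n. (flow x a)\<^sup>2) = (\<Sum>a<n. if level (shift a) = width a
      then (charge (width a) / (4 * 8 ^ (k - width a)))\<^sup>2 else 0)"
      using True by (intro sum.cong) (auto simp: flow_def)
    also have "\<dots> = (\<Sum>m = 1..k. 4 * 8 ^ (k - m) * (2 ^ (m - 1) * (charge m / (4 * 8 ^ (k - m)))\<^sup>2))"
      by (rule sum_over_exact_level)
    also have "\<dots> = (\<Sum>m = 1..k. 2 ^ (m - 1) * (charge m)\<^sup>2 / (4 * 8 ^ (k - m)))"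
      by (intro sum.cong) (auto simp: power2_eq_square)
    finally show ?thesis using True by (simp add: L2_set_def R_def)
  qed (simp add: L2_set_def flow_def)
  then show ?thesis
    using expectation_level[of "\<lambda>m. if m = 0 then R else 0"] by (simp add: sum_atMost_split R_def)
qed

lemma sum_powers_of_4: "(\<Sum>r = Suc m..m + j. 4 ^ (m + j - r)) = ((4::real) ^ j - 1) / 3"
proof (induction j)
  case (Suc j)
  have "(\<Sum>r = Suc m..m + Suc j. 4 ^ (m + Suc j - r)) = (\<Sum>r = Suc m..m + j. 4 ^ Suc (m + j - r)) + (1::real)"
    by (simp add: Suc_diff_le)
  then show ?case by (simp add: Suc.IH flip: sum_distrib_left)
qed simp

text \<open>
  The widths \<open>r \<ge> m\<close> act on a point of level \<open>m\<close>, and their number decays like \<open>4 ^ (-r)\<close>, so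
  the charge is at most a fixed fraction of the number of coordinates of width \<open>m\<close>. The value of
  \<open>f\<close> changes under at most 3/8 of the flips of width \<open>m\<close> (1/2 if \<open>m = 1\<close>) and under at most 3/4
  of those of a larger width; the coordinates of larger width together number at most a third of
  those of width \<open>m\<close>.
\<close>

lemma charge_le:
  assumes m: "m \<in> {1..k}"
  shows "\<bar>charge m\<bar> \<le> (if m = 1 then 3 / 4 else 5 / 8) * (4 * 8 ^ (k - m) * 2 ^ m)"
proof -
  define D where "D = (\<lambda>r. \<Sum>j\<le>r. level_size j * (((-1) ^ m - (-1) ^ j) / 2) :: real)"
  have D: "D r = ((-1) ^ m * 2 ^ r - ((-2) ^ r + 2) / 3) / 2" for r
  proof -
    have "D r = ((-1) ^ m * (\<Sum>j\<le>r. level_size j) - (\<Sum>j\<le>r. level_size j * (-1) ^ j)) / 2"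
      unfolding D_def sum_distrib_left sum_subtractf[symmetric] sum_divide_distrib
      by (intro sum.cong) (auto simp: algebra_simps)
    then show ?thesis by (simp add: sum_level_size sum_alternating_levels)
  qed
  have minus2: "(-2) ^ r = (-1) ^ r * (2::real) ^ r" for r
    by (simp flip: power_mult_distrib)
  have Dm: "\<bar>D m\<bar> \<le> (if m = 1 then 1 / 2 else 3 / 8) * 2 ^ m"
  proof -
    consider "m = 1" | "m = 2" | "m \<ge> 3" using m by force
    then show ?thesis
    proof cases
      case 3
      then have "(2::real) ^ 3 \<le> 2 ^ m" by (intro power_increasing) auto
      then show ?thesis using 3 by (cases "even m") (auto simp: D minus2 field_simps)
    qed (simp_all add: D)
  qed
  have Dr: "\<bar>D r\<bar> \<le> 3 / 4 * 2 ^ r" if "r > m" for r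
  proof -
    have "(2::real) ^ 2 \<le> 2 ^ r" using that m by (intro power_increasing) auto
    then show ?thesis by (cases "even m"; cases "even r") (auto simp: D minus2 field_simps)
  qed
  obtain j where j: "k = m + j" using m by (metis atLeastAtMost_iff le_Suc_ex)
  have split: "{1..k} \<inter> {m..} = insert m {Suc m..k}" using m by auto
  have "charge m = (\<Sum>r\<in>{1..k} \<inter> {m..}. 4 * 8 ^ (k - r) * D r)"
    unfolding charge_def D_def by (subst sum.inter_restrict) (auto intro!: sum.cong)
  also have "\<dots> = 4 * 8 ^ (k - m) * D m + (\<Sum>r = Suc m..k. 4 * 8 ^ (k - r) * D r)"
    unfolding split by simp
  finally have "\<bar>charge m\<bar> \<le> 4 * 8 ^ (k - m) * \<bar>D m\<bar> + (\<Sum>r = Suc m..k. 4 * 8 ^ (k - r) * \<bar>D r\<bar>)"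
    using abs_triangle_ineq[of "4 * 8 ^ (k - m) * D m" "\<Sum>r = Suc m..k. 4 * 8 ^ (k - r) * D r"]
      sum_abs[of "\<lambda>r. 4 * 8 ^ (k - r) * D r" "{Suc m..k}"]
    by (simp add: abs_mult)
  also have "\<dots> \<le> 4 * 8 ^ (k - m) * ((if m = 1 then 1 / 2 else 3 / 8) * 2 ^ m)
      + (\<Sum>r = Suc m..k. 4 * 8 ^ (k - r) * (3 / 4 * 2 ^ r))"
    by (intro add_mono mult_left_mono sum_mono Dm Dr) auto
  also have "(\<Sum>r = Suc m..k. 4 * 8 ^ (k - r) * (3 / 4 * 2 ^ r)) = (\<Sum>r = Suc m..k. 3 * 2 ^ k * (4::real) ^ (k - r))"
  proof (intro sum.cong refl)
    fix r assume "r \<in> {Suc m..k}"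
    then obtain i where "k = r + i" by (metis atLeastAtMost_iff le_Suc_ex)
    then show "4 * 8 ^ (k - r) * (3 / 4 * 2 ^ r) = 3 * 2 ^ k * (4::real) ^ (k - r)"
      by (simp add: power_add) (simp flip: power_mult_distrib)
  qed
  also have "\<dots> = 2 ^ k * (4 ^ (k - m) - 1)"
    using sum_powers_of_4[of m j] by (simp add: j flip: sum_distrib_left)
  also have "\<dots> \<le> 2 ^ k * 4 ^ (k - m)" by simp
  also have "\<dots> = 4 * 8 ^ (k - m) * (1 / 4 * 2 ^ m)"
    by (simp add: j power_add) (simp flip: power_mult_distrib)
  finally show ?thesis by (simp add: algebra_simps split: if_splits)
qed

text \<open>
  By \<open>charge_le\<close> each level adds at most a constant multiple of \<open>8 ^ k\<close> to the squared norm of the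
  flow in state 0, a state of probability \<open>2 ^ (-k)\<close>. The cost is thus of order \<open>sqrt (2 ^ k * k)\<close>.
\<close>

lemma beckmann_f_le: "beckmann n f \<le> sqrt (2 ^ k * (9 / 8 + 25 / 32 * (real k - 1)))"
proof -
  have "(\<Sum>m = 1..k. 2 ^ (m - 1) * (charge m)\<^sup>2 / (4 * 8 ^ (k - m)))
      \<le> (\<Sum>m = 1..k. 8 ^ k * (if m = 1 then 9 / 8 else 25 / 32))"
  proof (rule sum_mono)
    fix m assume m: "m \<in> {1..k}"
    define \<rho> :: real where "\<rho> = (if m = 1 then 3 / 4 else 5 / 8)"
    obtain j i where j: "k = m + j" and i: "m = Suc i"
      using m by (metis One_nat_def Suc_le_D atLeastAtMost_iff le_Suc_ex)
    have "(charge m)\<^sup>2 \<le> (\<rho> * (4 * 8 ^ (k - m) * 2 ^ m))\<^sup>2"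
      using charge_le[OF m] by (intro abs_le_square_iff[THEN iffD1]) (auto simp: \<rho>_def)
    then have "2 ^ (m - 1) * (charge m)\<^sup>2 / (4 * 8 ^ (k - m))
        \<le> 2 ^ (m - 1) * (\<rho> * (4 * 8 ^ (k - m) * 2 ^ m))\<^sup>2 / (4 * 8 ^ (k - m))"
      by (intro divide_right_mono mult_left_mono) auto
    also have "\<dots> = 8 ^ k * (2 * \<rho>\<^sup>2)"
    proof -
      have "(2::real) ^ i * (2 ^ i * 2 ^ i) = 8 ^ i" by (simp flip: power_mult_distrib)
      then show ?thesis by (simp add: j i power_add power2_eq_square)
    qed
    also have "\<dots> = 8 ^ k * (if m = 1 then 9 / 8 else 25 / 32)"
      by (simp add: \<rho>_def power2_eq_square)
    finally show "2 ^ (m - 1) * (charge m)\<^sup>2 / (4 * 8 ^ (k - m))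
        \<le> 8 ^ k * (if m = 1 then 9 / 8 else 25 / 32)" .
  qed
  also have "\<dots> = 8 ^ k * (9 / 8 + 25 / 32 * (real k - 1))"
  proof -
    have "{1..k} = insert 1 {2..k}" using k by auto
    then show ?thesis using k by (simp add: of_nat_diff algebra_simps)
  qed
  finally have le: "(\<Sum>m = 1..k. 2 ^ (m - 1) * (charge m)\<^sup>2 / (4 * 8 ^ (k - m)))
      \<le> 8 ^ k * (9 / 8 + 25 / 32 * (real k - 1))" .
  have "beckmann n f \<le> cube_expectation n (\<lambda>x. L2_set (flow x) {..<n})"
    by (rule beckmann_le) (rule divergence_flow)
  also have "\<dots> \<le> sqrt (8 ^ k * (9 / 8 + 25 / 32 * (real k - 1))) / 2 ^ k"
    unfolding flow_cost using le by (intro divide_right_mono real_sqrt_le_mono) auto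
  also have "\<dots> = sqrt (2 ^ k * (9 / 8 + 25 / 32 * (real k - 1)))"
  proof -
    have "(8::real) ^ k = (2 ^ k)\<^sup>2 * 2 ^ k"
      by (simp add: power2_eq_square flip: power_mult_distrib)
    then show ?thesis by (simp add: real_sqrt_mult)
  qed
  finally show ?thesis .
qed

section \<open>Edge weights with equal contributions of all levels\<close>

text \<open>
  The squared norm of the weights is \<open>(\<gamma> m)\<^sup>2 / 4 + (\<gamma> (m + 1))\<^sup>2 / 2\<close> at a point of level
  \<open>m\<close> with \<open>2 \<le> m < k\<close>, so that 4/3 is the largest constant value of \<open>(\<gamma> m)\<^sup>2\<close>. From level 1 a
  flip of width 1 leads to level 0 in half of the cases instead of a quarter, hence the exceptional
  value 2/3.
\<close>

definition \<gamma> :: "nat \<Rightarrow> real" where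
  "\<gamma> m = sqrt (if m = 1 then 2 / 3 else 4 / 3)"

text \<open>The denominator is the square root of the number of coordinates of width \<open>m\<close>.\<close>

definition \<omega> :: "nat \<Rightarrow> real" where
  "\<omega> m = \<gamma> m / (sqrt (2 ^ k) * 2 ^ (k + 1 - m))"

text \<open>
  Only edges of width \<open>m\<close> between the levels \<open>m\<close> and \<open>m - 1\<close> get a weight. The level changes parity
  along them, so they are sensitive; and each point meets only two widths, which keeps the norms
  bounded while all \<open>k\<close> levels contribute to the expectation.
\<close>

definition weight :: "(nat \<Rightarrow> real) \<Rightarrow> nat \<Rightarrow> real" where
  "weight x a = (let m = width a; p = level (state x); q = level (state (flip x a))
     in if p = m \<and> q = m - 1 \<or> p = m - 1 \<and> q = m then \<omega> m else 0)"

lemma weight_flip: "weight (flip x a) a = weight x a"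
  by (auto simp: weight_def Let_def)

lemma weight_nonzero_sensitive:
  assumes "a < n" "weight x a \<noteq> 0"
  shows "f (flip x a) \<noteq> f x"
proof -
  obtain i where "width a = Suc i" using width_range[OF assms(1)] by (cases "width a") auto
  then show ?thesis using assms(2)
    by (auto simp: weight_def f_def Let_def minus_one_power_iff split: if_splits)
qed

lemma sum_sensitive_weights:
  fixes \<phi> :: "real \<Rightarrow> real"
  assumes x: "x \<in> cube n" and "\<phi> 0 = 0"
  defines "p \<equiv> level (state x)"
  shows "(\<Sum>a | a < n \<and> f (flip x a) \<noteq> f x. \<phi> (weight x a)) =
    (if 1 \<le> p then 4 * 8 ^ (k - p) * level_size (p - 1) * \<phi> (\<omega> p) else 0) +
    (if p < k then 4 * 8 ^ (k - Suc p) * 2 ^ p * \<phi> (\<omega> (Suc p)) else 0)"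
proof -
  have "weight x a = 0" if "a < n" "f (flip x a) = f x" for a
    using weight_nonzero_sensitive that by blast
  then have "(\<Sum>a | a < n \<and> f (flip x a) \<noteq> f x. \<phi> (weight x a)) = (\<Sum>a<n. \<phi> (weight x a))"
    by (intro sum.mono_neutral_left) (auto simp: \<open>\<phi> 0 = 0\<close>)
  also have "\<dots> = (\<Sum>a<n. (\<lambda>m q. if p = m \<and> q = m - 1 \<or> p = m - 1 \<and> q = m then \<phi> (\<omega> m) else 0)
      (width a) (level (state (flip x a))))"
    using \<open>\<phi> 0 = 0\<close> by (auto simp: weight_def p_def Let_def intro!: sum.cong)
  also have "\<dots> = (\<Sum>m = 1..k. 4 * 8 ^ (k - m) * (if p \<le> m
      then \<Sum>j\<le>m. level_size j * (if p = m \<and> j = m - 1 \<or> p = m - 1 \<and> j = m then \<phi> (\<omega> m) else 0)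
      else 2 ^ m * (if p = m \<and> p = m - 1 \<or> p = m - 1 \<and> p = m then \<phi> (\<omega> m) else 0)))"
    unfolding p_def by (rule sum_transitions[OF x])
  also have "\<dots> = (\<Sum>m = 1..k.
      (if m = p then 4 * 8 ^ (k - p) * level_size (p - 1) * \<phi> (\<omega> p) else 0) +
      (if m = Suc p then 4 * 8 ^ (k - Suc p) * 2 ^ p * \<phi> (\<omega> (Suc p)) else 0))"
  proof (rule sum.cong[OF refl])
    fix m assume m: "m \<in> {1..k}"
    consider "m = p" | "m = Suc p" | "m \<noteq> p" "m \<noteq> Suc p" by blast
    then show "4 * 8 ^ (k - m) * (if p \<le> m
      then \<Sum>j\<le>m. level_size j * (if p = m \<and> j = m - 1 \<or> p = m - 1 \<and> j = m then \<phi> (\<omega> m) else 0)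
      else 2 ^ m * (if p = m \<and> p = m - 1 \<or> p = m - 1 \<and> p = m then \<phi> (\<omega> m) else 0)) =
      (if m = p then 4 * 8 ^ (k - p) * level_size (p - 1) * \<phi> (\<omega> p) else 0) +
      (if m = Suc p then 4 * 8 ^ (k - Suc p) * 2 ^ p * \<phi> (\<omega> (Suc p)) else 0)"
    proof cases
      case 1
      have "(\<Sum>j\<le>m. level_size j * (if p = m \<and> j = m - 1 \<or> p = m - 1 \<and> j = m then \<phi> (\<omega> m) else 0))
          = (\<Sum>j\<le>m. if j = p - 1 then level_size (p - 1) * \<phi> (\<omega> p) else 0)"
        using 1 m by (intro sum.cong) auto
      also have "\<dots> = level_size (p - 1) * \<phi> (\<omega> p)" using 1 by simp
      finally show ?thesis using 1 by simp
    next
      case 2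
      have "(\<Sum>j\<le>m. level_size j * (if p = m \<and> j = m - 1 \<or> p = m - 1 \<and> j = m then \<phi> (\<omega> m) else 0))
          = (\<Sum>j\<le>m. if j = m then 2 ^ p * \<phi> (\<omega> (Suc p)) else 0)"
        using 2 by (intro sum.cong) auto
      also have "\<dots> = 2 ^ p * \<phi> (\<omega> (Suc p))" by simp
      finally show ?thesis using 2 by simp
    next
      case 3
      then show ?thesis using m by (auto intro!: sum.neutral)
    qed
  qed
  also have "\<dots> = (if 1 \<le> p then 4 * 8 ^ (k - p) * level_size (p - 1) * \<phi> (\<omega> p) else 0) +
    (if p < k then 4 * 8 ^ (k - Suc p) * 2 ^ p * \<phi> (\<omega> (Suc p)) else 0)"
    using level_state_le[of x] by (auto simp: sum.distrib p_def)
  finally show ?thesis .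
qed

lemma \<omega>_identities:
  assumes "m \<in> {1..k}"
  shows "4 * 8 ^ (k - m) * (\<omega> m)\<^sup>2 = (\<gamma> m)\<^sup>2 / 2 ^ m"
    and "4 * 8 ^ (k - m) * \<omega> m = 2 * 4 ^ (k - m) * \<gamma> m / sqrt (2 ^ k)"
proof -
  obtain j where j: "k = m + j" using assms by (metis atLeastAtMost_iff le_Suc_ex)
  have 8: "(8::real) ^ j = 2 ^ j * 2 ^ j * 2 ^ j" and 4: "(4::real) ^ j = 2 ^ j * 2 ^ j"
    by (simp_all flip: power_mult_distrib)
  show "4 * 8 ^ (k - m) * (\<omega> m)\<^sup>2 = (\<gamma> m)\<^sup>2 / 2 ^ m"
    unfolding \<omega>_def
    by (simp add: j 8 power_divide power_mult_distrib power_add) (simp add: power2_eq_square)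
  show "4 * 8 ^ (k - m) * \<omega> m = 2 * 4 ^ (k - m) * \<gamma> m / sqrt (2 ^ k)"
    unfolding \<omega>_def by (simp add: j 8 4)
qed

lemma weights_le_1:
  assumes x: "x \<in> cube n"
  shows "(\<Sum>a | a < n \<and> f (flip x a) \<noteq> f x. (weight x a)\<^sup>2) \<le> 1"
proof -
  define p where "p = level (state x)"
  have p: "p \<le> k" using level_state_le by (simp add: p_def)
  have up: "(if p < k then 4 * 8 ^ (k - Suc p) * 2 ^ p * (\<omega> (Suc p))\<^sup>2 else 0) \<le> (\<gamma> (Suc p))\<^sup>2 / 2"
  proof (cases "p < k")
    case True
    then show ?thesis using \<omega>_identities(1)[of "Suc p"] by (simp add: field_simps)
  qed simp
  have down: "(if 1 \<le> p then 4 * 8 ^ (k - p) * level_size (p - 1) * (\<omega> p)\<^sup>2 else 0)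
      = (if 1 \<le> p then level_size (p - 1) * ((\<gamma> p)\<^sup>2 / 2 ^ p) else 0)"
  proof (cases "1 \<le> p")
    case True
    have "4 * 8 ^ (k - p) * level_size (p - 1) * (\<omega> p)\<^sup>2
        = level_size (p - 1) * (4 * 8 ^ (k - p) * (\<omega> p)\<^sup>2)"
      by simp
    also have "\<dots> = level_size (p - 1) * ((\<gamma> p)\<^sup>2 / 2 ^ p)"
      using True p by (subst \<omega>_identities(1)) auto
    finally show ?thesis using True by simp
  qed simp
  have "(\<Sum>a | a < n \<and> f (flip x a) \<noteq> f x. (weight x a)\<^sup>2) =
      (if 1 \<le> p then 4 * 8 ^ (k - p) * level_size (p - 1) * (\<omega> p)\<^sup>2 else 0) +
      (if p < k then 4 * 8 ^ (k - Suc p) * 2 ^ p * (\<omega> (Suc p))\<^sup>2 else 0)"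
    unfolding p_def by (rule sum_sensitive_weights[OF x, of "\<lambda>u. u\<^sup>2"]) simp
  also have "\<dots> \<le> (if 1 \<le> p then level_size (p - 1) * ((\<gamma> p)\<^sup>2 / 2 ^ p) else 0) + (\<gamma> (Suc p))\<^sup>2 / 2"
    unfolding down by (rule add_left_mono[OF up])
  also have "\<dots> \<le> 1"
  proof -
    consider "p = 0" | "p = 1" | i where "p = Suc (Suc i)" by (metis One_nat_def not0_implies_Suc)
    then show ?thesis by cases (simp_all add: \<gamma>_def)
  qed
  finally show ?thesis .
qed

text \<open>
  Each width \<open>m \<ge> 2\<close> contributes the same amount; this is where the lower bound becomes linear
  in \<open>k\<close>.
\<close>

lemma expectation_weights:
  "cube_expectation n (\<lambda>x. \<Sum>a | a < n \<and> f (flip x a) \<noteq> f x. weight x a)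
     = 2 * sqrt (2 ^ k) * ((real k - 1) / sqrt 12 + 1 / sqrt 6)"
proof -
  \<comment> \<open>\<open>E m\<close> is the total weight of width \<open>m\<close> over one representative of each state, seen from one end.\<close>
  define X where "X = (\<lambda>m. 4 * 8 ^ (k - m) * \<omega> m)"
  define E where "E = (\<lambda>m. 2 ^ (m - 1) * level_size (m - 1) * X m)"
  have "cube_expectation n (\<lambda>x. \<Sum>a | a < n \<and> f (flip x a) \<noteq> f x. weight x a)
      = cube_expectation n (\<lambda>x. (\<lambda>p. (if 1 \<le> p then level_size (p - 1) * X p else 0) +
          (if p < k then 2 ^ p * X (Suc p) else 0)) (level (state x)))"
    unfolding cube_expectation_eq
    using sum_sensitive_weights[of _ "\<lambda>u. u"]
    by (intro arg_cong[of _ _ "\<lambda>u. u / 2 ^ n"] sum.cong) (auto simp: X_def)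
  also have "\<dots> = (\<Sum>p\<le>k. level_size p * ((if 1 \<le> p then level_size (p - 1) * X p else 0) +
          (if p < k then 2 ^ p * X (Suc p) else 0))) / 2 ^ k"
    by (rule expectation_level)
  also have "(\<Sum>p\<le>k. level_size p * ((if 1 \<le> p then level_size (p - 1) * X p else 0) +
          (if p < k then 2 ^ p * X (Suc p) else 0)))
      = (\<Sum>p\<le>k. if 1 \<le> p then E p else 0) + (\<Sum>p\<le>k. if p < k then E (Suc p) else 0)"
    unfolding sum.distrib[symmetric] E_def
    by (intro sum.cong refl) (auto simp: algebra_simps level_size_def)
  also have "(\<Sum>p\<le>k. if 1 \<le> p then E p else 0) = (\<Sum>m = 1..k. E m)"
    by (rule sum.mono_neutral_cong_right) auto
  also have "(\<Sum>p\<le>k. if p < k then E (Suc p) else 0) = (\<Sum>p<k. E (Suc p))"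
    by (rule sum.mono_neutral_cong_right) auto
  also have "\<dots> = (\<Sum>m = 1..k. E m)"
    by (rule sum.reindex_bij_witness[of _ "\<lambda>m. m - 1" Suc]) auto
  also have "(\<Sum>m = 1..k. E m) = (\<Sum>m = 1..k. 2 ^ k * sqrt (2 ^ k) * (if m = 1 then 1 / sqrt 6 else 1 / sqrt 12))"
  proof (rule sum.cong[OF refl])
    fix m assume m: "m \<in> {1..k}"
    have X: "X m = 2 * 4 ^ (k - m) * \<gamma> m / sqrt (2 ^ k)"
      unfolding X_def by (rule \<omega>_identities(2)[OF m])
    obtain j where j: "k = m + j" using m by (metis atLeastAtMost_iff le_Suc_ex)
    have 4: "(4::real) ^ i = 2 ^ i * 2 ^ i" for i by (simp flip: power_mult_distrib)
    have g1: "sqrt (2 / 3) = 2 / sqrt 6" and g2: "sqrt (4 / 3) = 4 / sqrt 12"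
      by (rule real_sqrt_unique; simp add: power_divide)+
    have E2: "E m * sqrt (2 ^ k) = 2 ^ k * 2 ^ k * (if m = 1 then 1 / sqrt 6 else 1 / sqrt 12)"
    proof (cases "m = 1")
      case True
      then show ?thesis
        unfolding E_def X by (simp add: j \<gamma>_def g1 4)
    next
      case False
      then obtain i where "m = Suc (Suc i)" using m by (metis One_nat_def atLeastAtMost_iff not0_implies_Suc not_one_le_zero)
      then show ?thesis
        unfolding E_def X by (simp add: j \<gamma>_def g2 4 power_add)
    qed
    also have "\<dots> = 2 ^ k * sqrt (2 ^ k) * (if m = 1 then 1 / sqrt 6 else 1 / sqrt 12) * sqrt (2 ^ k)"
      by simp
    finally show "E m = 2 ^ k * sqrt (2 ^ k) * (if m = 1 then 1 / sqrt 6 else 1 / sqrt 12)"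
      by (rule mult_right_cancel[THEN iffD1, rotated]) simp
  qed
  also have "(\<Sum>m = 1..k. 2 ^ k * sqrt (2 ^ k) * (if m = 1 then 1 / sqrt 6 else 1 / sqrt 12))
      = 2 ^ k * sqrt (2 ^ k) * ((real k - 1) / sqrt 12 + 1 / sqrt 6)"
  proof -
    have "{1..k} = insert 1 {2..k}" using k by auto
    then show ?thesis using k by (simp add: of_nat_diff algebra_simps)
  qed
  also have "(2 ^ k * sqrt (2 ^ k) * ((real k - 1) / sqrt 12 + 1 / sqrt 6)
      + 2 ^ k * sqrt (2 ^ k) * ((real k - 1) / sqrt 12 + 1 / sqrt 6)) / 2 ^ k
      = 2 * sqrt (2 ^ k) * ((real k - 1) / sqrt 12 + 1 / sqrt 6)"
  proof -
    have "(N * s * c + N * s * c) / N = 2 * s * c" if "N \<noteq> 0" for N s c :: real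
      using that by (simp add: field_simps)
    then show ?thesis by simp
  qed
  finally show ?thesis .
qed

lemma T_theta_f_ge:
  "sqrt (2 ^ k) * ((real k - 1) / sqrt 12 + 1 / sqrt 6) \<le> T_theta n f \<theta>"
  using T_theta_ge_edge_weights[OF f_boolean, of weight \<theta>]
  by (simp add: weight_flip weights_le_1 expectation_weights)

end

section \<open>Comparing the two functionals\<close>

context layered_parity begin

text \<open>At level 1, where \<open>f\<close> is \<open>-1\<close>, no flip lowers \<open>f\<close> and some flips raise it, so the charge is negative.\<close>

lemma beckmann_f_pos: "beckmann n f > 0"
proof -
  have "charge 1 \<noteq> 0"
  proof -
    have D: "(\<Sum>j\<le>m. level_size j * (((-1) ^ 1 - (-1) ^ j) / 2)) = - (2 ^ m + ((-2) ^ m + 2) / 3) / (2::real)" for m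
    proof -
      have "(\<Sum>j\<le>m. level_size j * (((-1) ^ 1 - (-1) ^ j) / 2))
          = - ((\<Sum>j\<le>m. level_size j) + (\<Sum>j\<le>m. level_size j * (-1) ^ j)) / 2"
        unfolding sum.distrib[symmetric] sum_divide_distrib sum_negf[symmetric]
        by (intro sum.cong) (auto simp: algebra_simps)
      then show ?thesis by (simp add: sum_level_size sum_alternating_levels)
    qed
    have neg: "- (2 ^ m + ((-2) ^ m + 2) / 3) / (2::real) < 0" for m :: nat
    proof -
      have "\<bar>(-2::real) ^ m\<bar> = 2 ^ m" by (simp add: power_abs)
      then have "- (2 ^ m) \<le> (-2::real) ^ m" by linarith
      moreover have "(2::real) ^ m > 0" by simp
      moreover have "- (a + (b + 2) / 3) / 2 < 0" if "- a \<le> b" "a > 0" for a b :: real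
        using that by (simp add: field_simps)
      ultimately show ?thesis by blast
    qed
    have "charge 1 < 0"
      unfolding charge_def D
      using sum_strict_mono[of "{1..k}" "\<lambda>m. 4 * 8 ^ (k - m) *
          (if 1 \<le> m then - (2 ^ m + ((-2) ^ m + 2) / 3) / (2::real) else 0)" "\<lambda>_. 0"] k neg
      by (simp add: mult_pos_neg del: divide_less_0_iff)
    then show ?thesis by simp
  qed
  moreover obtain y where "y \<in> cube n" "state y = 1"
  proof -
    have "(1::nat) < 2 ^ k" using k less_exp[of k] by linarith
    then have "{x \<in> cube n. state x = 1} \<noteq> {}"
      using card_state_fibre[of 1] by (metis card.empty mult_0 power_not_zero zero_neq_numeral)
    then show ?thesis using that by blast
  qed
  moreover have "level 1 = 1" using level_eq_Suc[of 0 1] by simp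
  ultimately have "laplacian n f y \<noteq> 0" by (simp add: laplacian_f)
  then show ?thesis
    using beckmann_pos[OF divergence_flow \<open>y \<in> cube n\<close>] by blast
qed

text \<open>
  After squaring, with \<open>u = k - 1\<close>, this is a comparison of quadratic polynomials in \<open>u\<close> that holds
  coefficient by coefficient.
\<close>

lemma beckmann_f_times_ratio_le:
  "3 / (4 * sqrt 6) * sqrt (real k) * beckmann n f \<le> sqrt (2 ^ k) * ((real k - 1) / sqrt 12 + 1 / sqrt 6)"
proof -
  define u where "u = real k - 1"
  have u: "u \<ge> 0" using k by (simp add: u_def)
  have sqrt6: "sqrt 12 = sqrt 6 * sqrt 2" by (simp flip: real_sqrt_mult)
  have "14 / 10 \<le> sqrt 2" by (rule real_le_rsqrt) (simp add: power2_eq_square)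
  have "3 / (4 * sqrt 6) * sqrt (real k) * beckmann n f
      \<le> 3 / (4 * sqrt 6) * sqrt (real k) * sqrt (2 ^ k * (9 / 8 + 25 / 32 * (real k - 1)))"
    by (intro mult_left_mono beckmann_f_le) auto
  also have "\<dots> = sqrt (2 ^ k) * (sqrt (9 * (u + 1) * (9 / 8 + 25 / 32 * u)) / (4 * sqrt 6))"
    by (simp add: u_def real_sqrt_mult)
  also have "\<dots> \<le> sqrt (2 ^ k) * (4 * (u / sqrt 2 + 1) / (4 * sqrt 6))"
  proof (intro mult_left_mono divide_right_mono)
    have "9 * (u + 1) * (9 / 8 + 25 / 32 * u) \<le> 16 * (u\<^sup>2 / 2 + 14 / 10 * u + 1)"
    proof -
      have eq: "9 * (u + 1) * (9 / 8 + 25 / 32 * u) = 225 / 32 * u\<^sup>2 + 549 / 32 * u + 81 / 8"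
        by (simp add: field_simps power2_eq_square)
      show ?thesis unfolding eq using u zero_le_power2[of u] by argo
    qed
    also have "\<dots> \<le> 16 * (u\<^sup>2 / 2 + sqrt 2 * u + 1)"
      using mult_right_mono[OF \<open>14 / 10 \<le> sqrt 2\<close> u] by argo
    also have "\<dots> = (4 * (u / sqrt 2 + 1))\<^sup>2"
      by (simp add: power2_eq_square field_simps)
    finally show "sqrt (9 * (u + 1) * (9 / 8 + 25 / 32 * u)) \<le> 4 * (u / sqrt 2 + 1)"
      using u by (intro real_le_lsqrt) auto
  qed auto
  also have "4 * (u / sqrt 2 + 1) / (4 * sqrt 6) = u / sqrt 12 + 1 / sqrt 6"
    by (simp add: sqrt6 field_simps)
  finally show ?thesis by (simp add: u_def)
qed

end

text \<open>
  The coordinates are enumerated by triples of a width, a string of that width and a copy number;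
  there are exactly \<open>cube_dim k\<close> of them.
\<close>

lemma ex_layered_parity:
  assumes "k \<ge> 1"
  obtains width shift where "layered_parity k (cube_dim k) width shift"
proof -
  define I where "I = (SIGMA m:{1..k}. {..<2 ^ m :: nat} \<times> {..<4 * 8 ^ (k - m) :: nat})"
  have "finite I" by (simp add: I_def)
  have card_I: "card I = cube_dim k"
  proof -
    have "real (card I) = (\<Sum>m = 1..k. 2 ^ m * (4 * 8 ^ (k - m)))"
      by (simp add: I_def card_cartesian_product)
    also have "\<dots> = (\<Sum>m = 1..k. 4 * 2 ^ k * 4 ^ (k - m))"
    proof (intro sum.cong refl)
      fix m assume "m \<in> {1..k}"
      then obtain j where "k = m + j" by (metis atLeastAtMost_iff le_Suc_ex)
      moreover have "(8::real) ^ j = 2 ^ j * 4 ^ j" by (simp flip: power_mult_distrib)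
      ultimately show "2 ^ m * (4 * 8 ^ (k - m)) = 4 * 2 ^ k * (4::real) ^ (k - m)"
        by (simp add: power_add)
    qed
    also have "\<dots> = 4 * 2 ^ k * (\<Sum>i<k. 4 ^ i)"
      unfolding sum_distrib_left
      by (rule sum.reindex_bij_witness[of _ "\<lambda>i. k - i" "\<lambda>m. k - m"]) auto
    also have "\<dots> = real (cube_dim k)"
    proof -
      have "(4::real) ^ k - 1 = 3 * (\<Sum>i<k. 4 ^ i)" by (simp add: sum_gp_strict field_simps)
      then show ?thesis by (simp add: real_cube_dim)
    qed
    finally show ?thesis by simp
  qed
  obtain e where "bij_betw e {0..<card I} I"
    using ex_bij_betw_nat_finite[OF \<open>finite I\<close>] by blast
  then have e: "bij_betw e {..<cube_dim k} I" by (simp add: card_I atLeast0LessThan)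
  have "layered_parity k (cube_dim k) (\<lambda>a. fst (e a)) (\<lambda>a. fst (snd (e a)))"
  proof
    fix a assume "a < cube_dim k"
    then have "e a \<in> I" using e by (auto simp: bij_betw_def)
    then show "fst (e a) \<in> {1..k}" "fst (snd (e a)) < 2 ^ fst (e a)" by (auto simp: I_def)
  next
    fix m d :: nat assume md: "m \<in> {1..k}" "d < 2 ^ m"
    have "bij_betw e {a. a < cube_dim k \<and> fst (e a) = m \<and> fst (snd (e a)) = d}
        {i \<in> I. fst i = m \<and> fst (snd i) = d}"
      using e by (auto simp: bij_betw_def inj_on_def)
    then have "card {a. a < cube_dim k \<and> fst (e a) = m \<and> fst (snd (e a)) = d}
        = card {i \<in> I. fst i = m \<and> fst (snd i) = d}"
      by (rule bij_betw_same_card)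
    also have "{i \<in> I. fst i = m \<and> fst (snd i) = d} = {m} \<times> {d} \<times> {..<4 * 8 ^ (k - m)}"
      using md by (auto simp: I_def)
    finally show "card {a. a < cube_dim k \<and> fst (e a) = m \<and> fst (snd (e a)) = d} = 4 * 8 ^ (k - m)"
      by (simp add: card_cartesian_product)
  qed (use assms in auto)
  then show ?thesis by (rule that)
qed

lemma ex_large_ratio:
  assumes "k \<ge> 1"
  shows "\<exists>f \<in> boolean_functions (cube_dim k). beckmann (cube_dim k) f > 0 \<and>
    T_frac (cube_dim k) f / beckmann (cube_dim k) f \<ge> 3 / (4 * sqrt 6) * sqrt (real k) \<and>
    T_col (cube_dim k) f / beckmann (cube_dim k) f \<ge> 3 / (4 * sqrt 6) * sqrt (real k)"
proof -
  obtain width shift where "layered_parity k (cube_dim k) width shift"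
    using ex_layered_parity[OF assms] .
  then interpret layered_parity k "cube_dim k" width shift .
  note lower = T_frac_geI[OF T_theta_f_ge]
  show ?thesis
    using beckmann_f_pos order_trans[OF beckmann_f_times_ratio_le lower(1)]
      order_trans[OF beckmann_f_times_ratio_le lower(2)] f_boolean
    by (intro bexI[of _ f]) (auto simp: pos_le_divide_eq)
qed

lemma cube_dim_bounds:
  assumes "k \<ge> 1"
  shows "real k \<le> ln (real (cube_dim k))" "ln (real (cube_dim k)) \<le> real k * ln 16"
proof -
  have 8: "(8::real) ^ k = 2 ^ k * 4 ^ k" by (simp flip: power_mult_distrib)
  have eq: "real (cube_dim k) = 4 / 3 * (8 ^ k - 2 ^ k)"
    by (simp add: real_cube_dim 8 field_simps)
  have "(4::real) ^ 1 \<le> 4 ^ k" using assms by (intro power_increasing) auto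
  then have "(2::real) ^ k * 4 \<le> 2 ^ k * 4 ^ k" by simp
  then have lower: "8 ^ k \<le> real (cube_dim k)" unfolding eq 8[symmetric] by simp
  have "(2::real) ^ 1 \<le> 2 ^ k" using assms by (intro power_increasing) auto
  then have "(8::real) ^ k * 2 \<le> 8 ^ k * 2 ^ k" by simp
  also have "\<dots> = 16 ^ k" by (simp flip: power_mult_distrib)
  finally have "2 * 8 ^ k \<le> (16::real) ^ k" by simp
  moreover have "real (cube_dim k) \<le> 2 * 8 ^ k"
  proof -
    have "(0::real) \<le> 8 ^ k" "(0::real) \<le> 2 ^ k" by auto
    then show ?thesis unfolding eq by argo
  qed
  ultimately have upper: "real (cube_dim k) \<le> 16 ^ k" by linarith
  have pos: "real (cube_dim k) > 0"
    using lower by (smt (verit) zero_less_power)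
  have "ln (8 ^ k) \<le> ln (real (cube_dim k))"
    using lower pos by (intro ln_mono) auto
  moreover have "real k * 1 \<le> real k * ln 8"
    using ln_ge_iff[of 8 1] exp_le by (intro mult_left_mono) auto
  ultimately show "real k \<le> ln (real (cube_dim k))" by (simp add: ln_realpow)
  have "ln (real (cube_dim k)) \<le> ln (16 ^ k)"
    using upper pos by (intro ln_mono) auto
  then show "ln (real (cube_dim k)) \<le> real k * ln 16" by (simp add: ln_realpow)
qed

theorem theorem5p5:
  "(\<exists>c::real>0.
      (\<forall>k\<ge>1. \<exists>f \<in> boolean_functions (cube_dim k).
          T_frac (cube_dim k) f / beckmann (cube_dim k) f \<ge> 3 / (4 * sqrt 6) * sqrt (real k) \<and>
          T_col (cube_dim k) f / beckmann (cube_dim k) f \<ge> 3 / (4 * sqrt 6) * sqrt (real k) \<and>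
          3 / (4 * sqrt 6) * sqrt (real k) \<ge> c * sqrt (ln (real (cube_dim k)))) \<and>
      filterlim (\<lambda>k. c * sqrt (ln (real (cube_dim k)))) at_top sequentially) \<and>
   \<not> (\<exists>C::real. \<forall>n. \<forall>f \<in> boolean_functions n. T_col n f \<le> C * beckmann n f)"
proof
  define c where "c = 3 / (4 * sqrt 6) / sqrt (ln 16)"
  have "c > 0" by (simp add: c_def)
  have *: "c * sqrt (ln (real (cube_dim k))) \<le> 3 / (4 * sqrt 6) * sqrt (real k)" if "k \<ge> 1" for k
  proof -
    have "sqrt (ln (real (cube_dim k))) \<le> sqrt (real k * ln 16)"
      using cube_dim_bounds[OF that] by simp
    then have "c * sqrt (ln (real (cube_dim k))) \<le> c * sqrt (real k * ln 16)"
      using \<open>c > 0\<close> by (intro mult_left_mono) auto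
    also have "\<dots> = 3 / (4 * sqrt 6) * sqrt (real k)" by (simp add: c_def real_sqrt_mult)
    finally show ?thesis .
  qed
  have lim: "filterlim (\<lambda>k. c * sqrt (ln (real (cube_dim k)))) at_top sequentially"
  proof (rule filterlim_at_top_mono)
    show "filterlim (\<lambda>k. c * sqrt (real k)) at_top sequentially"
      using \<open>c > 0\<close> by (intro filterlim_tendsto_pos_mult_at_top[OF tendsto_const]
          filterlim_compose[OF sqrt_at_top filterlim_real_sequentially])
    show "\<forall>\<^sub>F k in sequentially. c * sqrt (real k) \<le> c * sqrt (ln (real (cube_dim k)))"
      using eventually_ge_at_top[of 1]
      by eventually_elim (use \<open>c > 0\<close> cube_dim_bounds in \<open>auto intro!: mult_left_mono\<close>)
  qed
  show "\<exists>c::real>0.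
      (\<forall>k\<ge>1. \<exists>f \<in> boolean_functions (cube_dim k).
          T_frac (cube_dim k) f / beckmann (cube_dim k) f \<ge> 3 / (4 * sqrt 6) * sqrt (real k) \<and>
          T_col (cube_dim k) f / beckmann (cube_dim k) f \<ge> 3 / (4 * sqrt 6) * sqrt (real k) \<and>
          3 / (4 * sqrt 6) * sqrt (real k) \<ge> c * sqrt (ln (real (cube_dim k)))) \<and>
      filterlim (\<lambda>k. c * sqrt (ln (real (cube_dim k)))) at_top sequentially"
    using \<open>c > 0\<close> lim * ex_large_ratio by blast
  show "\<not> (\<exists>C::real. \<forall>n. \<forall>f \<in> boolean_functions n. T_col n f \<le> C * beckmann n f)"
  proof
    assume "\<exists>C::real. \<forall>n. \<forall>f \<in> boolean_functions n. T_col n f \<le> C * beckmann n f"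
    then obtain C where C: "\<And>n f. f \<in> boolean_functions n \<Longrightarrow> T_col n f \<le> C * beckmann n f" by blast
    have "\<forall>\<^sub>F k in sequentially. k \<ge> 1 \<and> C < c * sqrt (ln (real (cube_dim k)))"
      using lim by (intro eventually_conj eventually_ge_at_top) (auto simp: filterlim_at_top_dense)
    then obtain k where k: "k \<ge> 1" "C < c * sqrt (ln (real (cube_dim k)))"
      by (auto simp: eventually_sequentially)
    obtain f where f: "f \<in> boolean_functions (cube_dim k)" "beckmann (cube_dim k) f > 0"
      "T_col (cube_dim k) f / beckmann (cube_dim k) f \<ge> 3 / (4 * sqrt 6) * sqrt (real k)"
      using ex_large_ratio[OF k(1)] by blast
    have "T_col (cube_dim k) f / beckmann (cube_dim k) f \<le> C"
      using C[OF f(1)] f(2) by (simp add: pos_divide_le_eq)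
    with f(3) *[OF k(1)] k(2) show False by linarith
  qed
qed

end
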